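(* If $R$ is a PID, or more generally a Dedekind domain, then every infinite subset of $\operatorname{Spec}(R)$ is dense in $\operatorname{Spec}(R)$ with respect to the Zariski topology. *)

theory Defs
  imports "HOL-Analysis.Abstract_Topology" "HOL-Algebra.Algebra"
begin

section \<open>The prime spectrum and its Zariski topology\<close>

definition Spec :: "('a, 'b) ring_scheme \<Rightarrow> 'a set set" where
  "Spec R = {P. primeideal P R}"

definition vanishing :: "('a, 'b) ring_scheme \<Rightarrow> 'a set \<Rightarrow> 'a set set" where
  "vanishing R E = {P \<in> Spec R. E \<subseteq> P}"

definition zariski :: "('a, 'b) ring_scheme \<Rightarrow> 'a set topology" where
  "zariski R = topology (\<lambda>U. \<exists>E \<subseteq> carrier R. U = Spec R - vanishing R E)"

text \<open>The \<^const>\<open>topology\<close> constructor is only meaningful on families satisfying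
  \<^const>\<open>istopology\<close>, which is checked here.\<close>

lemma istopology_zariski:
  assumes "cring R"
  shows "istopology (\<lambda>U. \<exists>E \<subseteq> carrier R. U = Spec R - vanishing R E)"
  unfolding istopology_def
proof (intro conjI allI impI)
  interpret cring R by fact
  fix S T
  assume "\<exists>E \<subseteq> carrier R. S = Spec R - vanishing R E"
    and "\<exists>E \<subseteq> carrier R. T = Spec R - vanishing R E"
  then obtain E F where E: "E \<subseteq> carrier R" "S = Spec R - vanishing R E"
    and F: "F \<subseteq> carrier R" "T = Spec R - vanishing R F"
    by blast
  let ?G = "{e \<otimes>\<^bsub>R\<^esub> f | e f. e \<in> E \<and> f \<in> F}"
  have "?G \<subseteq> P \<longleftrightarrow> E \<subseteq> P \<or> F \<subseteq> P" if "primeideal P R" for P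
  proof -
    interpret P: primeideal P R by fact
    show ?thesis
    proof
      assume G: "?G \<subseteq> P"
      show "E \<subseteq> P \<or> F \<subseteq> P"
      proof (rule ccontr)
        assume "\<not> (E \<subseteq> P \<or> F \<subseteq> P)"
        then obtain e f where "e \<in> E" "e \<notin> P" "f \<in> F" "f \<notin> P" by blast
        moreover from this have "e \<otimes>\<^bsub>R\<^esub> f \<in> P" using G by blast
        ultimately show False using P.I_prime E(1) F(1) by blast
      qed
    next
      assume "E \<subseteq> P \<or> F \<subseteq> P"
      then show "?G \<subseteq> P"
        using E(1) F(1) P.I_l_closed P.I_r_closed by blast
    qed
  qed
  then have "S \<inter> T = Spec R - vanishing R ?G"
    unfolding E F vanishing_def Spec_def by (simp add: set_eq_iff) blast
  moreover have "?G \<subseteq> carrier R" using E(1) F(1) by auto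
  ultimately show "\<exists>G \<subseteq> carrier R. S \<inter> T = Spec R - vanishing R G" by blast
next
  fix \<K>
  assume "\<forall>K\<in>\<K>. \<exists>E \<subseteq> carrier R. K = Spec R - vanishing R E"
  then obtain h where h: "\<And>K. K \<in> \<K> \<Longrightarrow> h K \<subseteq> carrier R"
    "\<And>K. K \<in> \<K> \<Longrightarrow> K = Spec R - vanishing R (h K)"
    by metis
  have "\<Union>\<K> = (\<Union>K\<in>\<K>. Spec R - vanishing R (h K))"
    using h(2) by blast
  also have "\<dots> = Spec R - vanishing R (\<Union>K\<in>\<K>. h K)"
    unfolding vanishing_def by blast
  finally show "\<exists>E \<subseteq> carrier R. \<Union>\<K> = Spec R - vanishing R E"
    using h(1) by (intro exI[of _ "\<Union>K\<in>\<K>. h K"]) blast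
qed

lemma openin_zariski:
  assumes "cring R"
  shows "openin (zariski R) U \<longleftrightarrow> (\<exists>E \<subseteq> carrier R. U = Spec R - vanishing R E)"
  unfolding zariski_def topology_inverse'[OF istopology_zariski[OF assms]] ..

lemma topspace_zariski:
  assumes "cring R"
  shows "topspace (zariski R) = Spec R"
proof -
  interpret cring R by fact
  have "vanishing R (carrier R) = {}"
    unfolding vanishing_def Spec_def
    using primeideal.I_notcarr ideal.Icarr primeideal.axioms(1) by fastforce
  then have "openin (zariski R) (Spec R)"
    unfolding openin_zariski[OF assms] by (intro exI[of _ "carrier R"]) auto
  moreover have "U \<subseteq> Spec R" if "openin (zariski R) U" for U
    using that unfolding openin_zariski[OF assms] by blast
  ultimately show ?thesis
    unfolding topspace_def by blast
qed


section \<open>The field of fractions\<close>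

text \<open>HOL-Algebra has no field of fractions of a domain given by a carrier, so it is
  constructed here: the pair \<open>(a, s)\<close> with \<open>s \<noteq> \<zero>\<close> stands for \<open>a / s\<close>.\<close>

definition frac_pairs :: "('a, 'b) ring_scheme \<Rightarrow> ('a \<times> 'a) set" where
  "frac_pairs R = carrier R \<times> (carrier R - {\<zero>\<^bsub>R\<^esub>})"

definition frac_rel :: "('a, 'b) ring_scheme \<Rightarrow> (('a \<times> 'a) \<times> ('a \<times> 'a)) set" where
  "frac_rel R = {((a, s), (b, t)). (a, s) \<in> frac_pairs R \<and> (b, t) \<in> frac_pairs R
                   \<and> a \<otimes>\<^bsub>R\<^esub> t = b \<otimes>\<^bsub>R\<^esub> s}"

definition fraction :: "('a, 'b) ring_scheme \<Rightarrow> 'a \<Rightarrow> 'a \<Rightarrow> ('a \<times> 'a) set" where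
  "fraction R a s = frac_rel R `` {(a, s)}"

definition fraction_field :: "('a, 'b) ring_scheme \<Rightarrow> ('a \<times> 'a) set ring" where
  "fraction_field R =
     \<lparr> carrier = frac_pairs R // frac_rel R,
       monoid.mult = (\<lambda>x y. (\<Union>(a, s) \<in> x. \<Union>(b, t) \<in> y. fraction R (a \<otimes>\<^bsub>R\<^esub> b) (s \<otimes>\<^bsub>R\<^esub> t))),
       monoid.one = fraction R \<one>\<^bsub>R\<^esub> \<one>\<^bsub>R\<^esub>,
       ring.zero = fraction R \<zero>\<^bsub>R\<^esub> \<one>\<^bsub>R\<^esub>,
       ring.add = (\<lambda>x y. (\<Union>(a, s) \<in> x. \<Union>(b, t) \<in> y.
                fraction R ((a \<otimes>\<^bsub>R\<^esub> t) \<oplus>\<^bsub>R\<^esub> (b \<otimes>\<^bsub>R\<^esub> s)) (s \<otimes>\<^bsub>R\<^esub> t))) \<rparr>"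

definition to_frac :: "('a, 'b) ring_scheme \<Rightarrow> 'a \<Rightarrow> ('a \<times> 'a) set" where
  "to_frac R a = fraction R a \<one>\<^bsub>R\<^esub>"

context "domain"
begin

lemma frac_pairs_iff: "(a, s) \<in> frac_pairs R \<longleftrightarrow> a \<in> carrier R \<and> s \<in> carrier R \<and> s \<noteq> \<zero>"
  by (auto simp: frac_pairs_def)

lemma equiv_frac_rel: "equiv (frac_pairs R) (frac_rel R)"
proof (rule equivI)
  show "frac_rel R \<subseteq> frac_pairs R \<times> frac_pairs R"
    by (auto simp: frac_rel_def)
  show "refl_on (frac_pairs R) (frac_rel R)"
    by (auto simp: refl_on_def frac_rel_def)
  show "sym (frac_rel R)"
    by (auto simp: sym_def frac_rel_def)
  show "trans (frac_rel R)"
  proof (rule transI, clarsimp simp: frac_rel_def frac_pairs_iff)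
    fix a s b t c u
    assume c: "a \<in> carrier R" "s \<in> carrier R" "b \<in> carrier R" "t \<in> carrier R"
        "c \<in> carrier R" "u \<in> carrier R"
      and t: "t \<noteq> \<zero>" and e: "a \<otimes> t = b \<otimes> s" "b \<otimes> u = c \<otimes> t"
    have "t \<otimes> (a \<otimes> u) = (a \<otimes> t) \<otimes> u" using c by algebra
    also have "\<dots> = (b \<otimes> u) \<otimes> s" unfolding e(1) using c by algebra
    also have "\<dots> = t \<otimes> (c \<otimes> s)" unfolding e(2) using c by algebra
    finally show "a \<otimes> u = c \<otimes> s" using m_lcancel t c by simp
  qed
qed

lemma frac_eq_iff:
  assumes "a \<in> carrier R" "s \<in> carrier R" "s \<noteq> \<zero>" "b \<in> carrier R" "t \<in> carrier R" "t \<noteq> \<zero>"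
  shows "fraction R a s = fraction R b t \<longleftrightarrow> a \<otimes> t = b \<otimes> s"
  unfolding fraction_def using assms eq_equiv_class_iff[OF equiv_frac_rel, of "(a, s)" "(b, t)"]
  by (auto simp: frac_rel_def frac_pairs_iff)

lemma frac_closed:
  assumes "a \<in> carrier R" "s \<in> carrier R" "s \<noteq> \<zero>"
  shows "fraction R a s \<in> carrier (fraction_field R)"
  unfolding fraction_field_def fraction_def using assms by (auto intro!: quotientI simp: frac_pairs_iff)

lemma fraction_field_cases:
  assumes "x \<in> carrier (fraction_field R)"
  obtains a s where "a \<in> carrier R" "s \<in> carrier R" "s \<noteq> \<zero>" "x = fraction R a s"
  using assms unfolding fraction_field_def fraction_def
  by (auto elim!: quotientE simp: frac_pairs_iff)

lemma frac_mult:
  assumes "a \<in> carrier R" "s \<in> carrier R" "s \<noteq> \<zero>" "b \<in> carrier R" "t \<in> carrier R" "t \<noteq> \<zero>"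
  shows "fraction R a s \<otimes>\<^bsub>fraction_field R\<^esub> fraction R b t = fraction R (a \<otimes> b) (s \<otimes> t)"
proof -
  let ?f = "\<lambda>(a, s) (b, t). fraction R (a \<otimes> b) (s \<otimes> t)"
  have "?f respects2 (frac_rel R)"
  proof (rule congruent2I', clarsimp simp: frac_rel_def frac_pairs_iff)
    fix a s a' s' b t b' t'
    assume c: "a \<in> carrier R" "s \<in> carrier R" "a' \<in> carrier R" "s' \<in> carrier R"
        "b \<in> carrier R" "t \<in> carrier R" "b' \<in> carrier R" "t' \<in> carrier R"
        and n: "s \<noteq> \<zero>" "s' \<noteq> \<zero>" "t \<noteq> \<zero>" "t' \<noteq> \<zero>"
        and e: "a \<otimes> s' = a' \<otimes> s" "b \<otimes> t' = b' \<otimes> t"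
    have "(a \<otimes> b) \<otimes> (s' \<otimes> t') = (a \<otimes> s') \<otimes> (b \<otimes> t')" using c by algebra
    also have "\<dots> = (a' \<otimes> b') \<otimes> (s \<otimes> t)" unfolding e using c by algebra
    finally show "fraction R (a \<otimes> b) (s \<otimes> t) = fraction R (a' \<otimes> b') (s' \<otimes> t')"
      using c n by (subst frac_eq_iff) (auto simp: integral_iff)
  qed
  from UN_equiv_class2[OF equiv_frac_rel equiv_frac_rel this, of "(a, s)" "(b, t)"] show ?thesis
    using assms by (simp add: frac_pairs_iff fraction_field_def fraction_def[of R a s] fraction_def[of R b t]
        case_prod_unfold)
qed

lemma frac_add:
  assumes "a \<in> carrier R" "s \<in> carrier R" "s \<noteq> \<zero>" "b \<in> carrier R" "t \<in> carrier R" "t \<noteq> \<zero>"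
  shows "fraction R a s \<oplus>\<^bsub>fraction_field R\<^esub> fraction R b t = fraction R (a \<otimes> t \<oplus> b \<otimes> s) (s \<otimes> t)"
proof -
  let ?f = "\<lambda>(a, s) (b, t). fraction R (a \<otimes> t \<oplus> b \<otimes> s) (s \<otimes> t)"
  have "?f respects2 (frac_rel R)"
  proof (rule congruent2I', clarsimp simp: frac_rel_def frac_pairs_iff)
    fix a s a' s' b t b' t'
    assume c: "a \<in> carrier R" "s \<in> carrier R" "a' \<in> carrier R" "s' \<in> carrier R"
        "b \<in> carrier R" "t \<in> carrier R" "b' \<in> carrier R" "t' \<in> carrier R"
        and n: "s \<noteq> \<zero>" "s' \<noteq> \<zero>" "t \<noteq> \<zero>" "t' \<noteq> \<zero>"
        and e: "a \<otimes> s' = a' \<otimes> s" "b \<otimes> t' = b' \<otimes> t"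
    have "(a \<otimes> t \<oplus> b \<otimes> s) \<otimes> (s' \<otimes> t')
        = (a \<otimes> s') \<otimes> (t \<otimes> t') \<oplus> (b \<otimes> t') \<otimes> (s \<otimes> s')" using c by algebra
    also have "\<dots> = (a' \<otimes> t' \<oplus> b' \<otimes> s') \<otimes> (s \<otimes> t)" unfolding e using c by algebra
    finally show "fraction R (a \<otimes> t \<oplus> b \<otimes> s) (s \<otimes> t) = fraction R (a' \<otimes> t' \<oplus> b' \<otimes> s') (s' \<otimes> t')"
      using c n by (subst frac_eq_iff) (auto simp: integral_iff)
  qed
  from UN_equiv_class2[OF equiv_frac_rel equiv_frac_rel this, of "(a, s)" "(b, t)"] show ?thesis
    using assms by (simp add: frac_pairs_iff fraction_field_def fraction_def[of R a s] fraction_def[of R b t]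
        case_prod_unfold)
qed

lemma frac_zero: "\<zero>\<^bsub>fraction_field R\<^esub> = fraction R \<zero> \<one>"
  and frac_one: "\<one>\<^bsub>fraction_field R\<^esub> = fraction R \<one> \<one>"
  by (simp_all add: fraction_field_def)

lemma fraction_field_is_field: "field (fraction_field R)"
proof -
  let ?K = "fraction_field R"
  note s = frac_mult frac_add frac_zero frac_one frac_closed integral_iff
  have "cring ?K"
  proof (rule cringI)
    show "abelian_group ?K"
    proof (rule abelian_groupI)
      fix x y z assume "x \<in> carrier ?K" "y \<in> carrier ?K" "z \<in> carrier ?K"
      then show "(x \<oplus>\<^bsub>?K\<^esub> y) \<oplus>\<^bsub>?K\<^esub> z = x \<oplus>\<^bsub>?K\<^esub> (y \<oplus>\<^bsub>?K\<^esub> z)"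
      proof (elim fraction_field_cases)
        fix a t b u c v
        assume c: "a \<in> carrier R" "t \<in> carrier R" "b \<in> carrier R" "u \<in> carrier R"
            "c \<in> carrier R" "v \<in> carrier R"
          and n: "t \<noteq> \<zero>" "u \<noteq> \<zero>" "v \<noteq> \<zero>"
          and x: "x = fraction R a t" "y = fraction R b u" "z = fraction R c v"
        have "(a \<otimes> u \<oplus> b \<otimes> t) \<otimes> v \<oplus> c \<otimes> (t \<otimes> u) = a \<otimes> (u \<otimes> v) \<oplus> (b \<otimes> v \<oplus> c \<otimes> u) \<otimes> t"
          using c by algebra
        then show ?thesis unfolding x using c n by (simp add: s m_assoc)
      qed
    next
      fix x y assume "x \<in> carrier ?K" "y \<in> carrier ?K"
      then show "x \<oplus>\<^bsub>?K\<^esub> y = y \<oplus>\<^bsub>?K\<^esub> x"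
        by (elim fraction_field_cases) (simp add: s m_comm a_comm)
    next
      fix x assume "x \<in> carrier ?K"
      then obtain a t where a: "a \<in> carrier R" "t \<in> carrier R" "t \<noteq> \<zero>" "x = fraction R a t"
        by (elim fraction_field_cases)
      have "fraction R (\<ominus> a) t \<oplus>\<^bsub>?K\<^esub> x = \<zero>\<^bsub>?K\<^esub>"
        using a by (simp add: s frac_eq_iff l_minus l_neg)
      then show "\<exists>y \<in> carrier ?K. y \<oplus>\<^bsub>?K\<^esub> x = \<zero>\<^bsub>?K\<^esub>"
        using a by (intro bexI[of _ "fraction R (\<ominus> a) t"]) (simp_all add: frac_closed)
    qed (auto elim!: fraction_field_cases simp: s)
    show "comm_monoid ?K"
    proof (rule comm_monoidI)
      fix x y z assume "x \<in> carrier ?K" "y \<in> carrier ?K" "z \<in> carrier ?K"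
      then show "(x \<otimes>\<^bsub>?K\<^esub> y) \<otimes>\<^bsub>?K\<^esub> z = x \<otimes>\<^bsub>?K\<^esub> (y \<otimes>\<^bsub>?K\<^esub> z)"
        by (elim fraction_field_cases) (simp add: s m_assoc)
    next
      fix x y assume "x \<in> carrier ?K" "y \<in> carrier ?K"
      then show "x \<otimes>\<^bsub>?K\<^esub> y = y \<otimes>\<^bsub>?K\<^esub> x"
        by (elim fraction_field_cases) (simp add: s m_comm)
    qed (auto elim!: fraction_field_cases simp: s)
    fix x y z assume "x \<in> carrier ?K" "y \<in> carrier ?K" "z \<in> carrier ?K"
    then show "(x \<oplus>\<^bsub>?K\<^esub> y) \<otimes>\<^bsub>?K\<^esub> z = x \<otimes>\<^bsub>?K\<^esub> z \<oplus>\<^bsub>?K\<^esub> y \<otimes>\<^bsub>?K\<^esub> z"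
    proof (elim fraction_field_cases)
      fix a t b u c v
      assume c: "a \<in> carrier R" "t \<in> carrier R" "b \<in> carrier R" "u \<in> carrier R"
          "c \<in> carrier R" "v \<in> carrier R"
        and n: "t \<noteq> \<zero>" "u \<noteq> \<zero>" "v \<noteq> \<zero>"
        and x: "x = fraction R a t" "y = fraction R b u" "z = fraction R c v"
      have "((a \<otimes> u \<oplus> b \<otimes> t) \<otimes> c) \<otimes> ((t \<otimes> v) \<otimes> (u \<otimes> v))
          = ((a \<otimes> c) \<otimes> (u \<otimes> v) \<oplus> (b \<otimes> c) \<otimes> (t \<otimes> v)) \<otimes> ((t \<otimes> u) \<otimes> v)"
        using c by algebra
      then have "fraction R ((a \<otimes> u \<oplus> b \<otimes> t) \<otimes> c) ((t \<otimes> u) \<otimes> v)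
          = fraction R ((a \<otimes> c) \<otimes> (u \<otimes> v) \<oplus> (b \<otimes> c) \<otimes> (t \<otimes> v)) ((t \<otimes> v) \<otimes> (u \<otimes> v))"
        using c n by (subst frac_eq_iff) (simp_all add: integral_iff)
      then show ?thesis unfolding x using c n by (simp add: s)
    qed
  qed
  then show ?thesis
  proof (rule cring.cring_fieldI2)
    show "\<zero>\<^bsub>?K\<^esub> \<noteq> \<one>\<^bsub>?K\<^esub>" by (simp add: s frac_eq_iff)
    fix x assume "x \<in> carrier ?K" "x \<noteq> \<zero>\<^bsub>?K\<^esub>"
    then obtain a t where a: "a \<in> carrier R" "t \<in> carrier R" "t \<noteq> \<zero>" "x = fraction R a t" "a \<noteq> \<zero>"
      by (elim fraction_field_cases) (auto simp: s frac_eq_iff)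
    then show "\<exists>y \<in> carrier ?K. x \<otimes>\<^bsub>?K\<^esub> y = \<one>\<^bsub>?K\<^esub>"
      by (intro bexI[of _ "fraction R t a"]) (simp_all add: s frac_eq_iff m_comm)
  qed
qed

lemma to_frac_hom: "to_frac R \<in> ring_hom R (fraction_field R)"
  by (rule ring_hom_memI) (simp_all add: to_frac_def frac_closed frac_mult frac_add frac_one)

lemma inj_to_frac: "inj_on (to_frac R) (carrier R)"
  by (auto simp: inj_on_def to_frac_def frac_eq_iff)

end


section \<open>Dedekind domains\<close>

text \<open>Polynomials are lists with the leading coefficient first, so \<^term>\<open>hd p\<close> is
  the leading coefficient.\<close>

definition integral_over :: "('c, 'd) ring_scheme \<Rightarrow> 'c set \<Rightarrow> 'c \<Rightarrow> bool" where
  "integral_over S A x \<longleftrightarrow>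
     (\<exists>p \<in> carrier (A[X]\<^bsub>S\<^esub>). p \<noteq> [] \<and> hd p = \<one>\<^bsub>S\<^esub> \<and> ring.eval S p x = \<zero>\<^bsub>S\<^esub>)"

definition integrally_closed :: "('a, 'b) ring_scheme \<Rightarrow> bool" where
  "integrally_closed R \<longleftrightarrow>
     (\<forall>x \<in> carrier (fraction_field R).
        integral_over (fraction_field R) (to_frac R ` carrier R) x \<longrightarrow>
        x \<in> to_frac R ` carrier R)"

text \<open>Fields are allowed (Krull dimension at most one).\<close>

locale dedekind_domain = noetherian_domain +
  assumes integrally_closed: "integrally_closed R"
    and nonzero_prime_maximal: "\<lbrakk>primeideal P R; P \<noteq> {\<zero>}\<rbrakk> \<Longrightarrow> maximalideal P R"

lemma (in principal_domain) principal_domain_integrally_closed: "integrally_closed R"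
  unfolding integrally_closed_def
proof (intro ballI impI)
  let ?K = "fraction_field R" and ?A = "to_frac R ` carrier R"
  interpret K: field ?K by (rule fraction_field_is_field)
  have hom: "to_frac R \<in> ring_hom R ?K" by (rule to_frac_hom)
  interpret h: ring_hom_cring R ?K "to_frac R"
    by (intro ring_hom_cring.intro ring_hom_cring_axioms.intro hom is_cring K.is_cring)
  fix x assume "x \<in> carrier ?K" and int: "integral_over ?K ?A x"
  then obtain a0 s0 where as: "a0 \<in> carrier R" "s0 \<in> carrier R" "s0 \<noteq> \<zero>" "x = fraction R a0 s0"
    by (elim fraction_field_cases)
  have id: "ideal (PIdl a0) R" "ideal (PIdl s0) R" using as cgenideal_ideal by auto
  obtain d where d: "d \<in> carrier R" "PIdl a0 <+> PIdl s0 = PIdl d"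
    using exists_gen[OF add_ideals[OF id]] by blast
  have in_sum: "y \<in> PIdl d \<longleftrightarrow> (\<exists>u\<in>carrier R. \<exists>v\<in>carrier R. y = u \<otimes> a0 \<oplus> v \<otimes> s0)" for y
    unfolding d(2)[symmetric] unfolding set_add_def' cgenideal_def by auto
  have "a0 \<in> PIdl d"
    unfolding in_sum using as by (intro bexI[of _ \<one>] bexI[of _ \<zero>]) auto
  then obtain a where a: "a \<in> carrier R" "a0 = a \<otimes> d" unfolding cgenideal_def by auto
  have "s0 \<in> PIdl d"
    unfolding in_sum using as by (intro bexI[of _ \<one>] bexI[of _ \<zero>]) auto
  then obtain s where s: "s \<in> carrier R" "s0 = s \<otimes> d" unfolding cgenideal_def by auto
  have "d \<in> PIdl d" using cgenideal_self[OF d(1)] .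
  then obtain u v where uv: "u \<in> carrier R" "v \<in> carrier R" "d = u \<otimes> a0 \<oplus> v \<otimes> s0"
    unfolding in_sum by auto
  have nz: "d \<noteq> \<zero>" "s \<noteq> \<zero>" using as s d a by auto
  have "d \<otimes> \<one> = u \<otimes> a0 \<oplus> v \<otimes> s0" using uv(3) d by simp
  also have "\<dots> = d \<otimes> (u \<otimes> a \<oplus> v \<otimes> s)"
    unfolding a(2) s(2) using a(1) s(1) uv(1,2) d(1) by (simp add: r_distr m_ac)
  finally have bezout: "\<one> = u \<otimes> a \<oplus> v \<otimes> s"
    using m_lcancel[OF nz(1) d(1), of \<one> "u \<otimes> a \<oplus> v \<otimes> s"] a(1) s(1) uv(1,2) by simp
  have x: "x = fraction R a s"
    unfolding as(4) using as a s nz d by (subst frac_eq_iff) (simp_all add: m_ac)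
  then have xK: "x \<in> carrier ?K" using a s nz frac_closed by simp
  have xs: "x \<otimes>\<^bsub>?K\<^esub> to_frac R s = to_frac R a"
    unfolding x to_frac_def using a s nz
    by (simp add: frac_mult frac_eq_iff)
  have clear: "\<exists>r\<in>carrier R. ring.eval ?K q x \<otimes>\<^bsub>?K\<^esub> (to_frac R s [^]\<^bsub>?K\<^esub> length q)
                 = to_frac R (s \<otimes> r)" if "set q \<subseteq> ?A" for q
    using that
  proof (induction q)
    case Nil
    then show ?case using s by (intro bexI[of _ \<zero>]) simp_all
  next
    case (Cons c q)
    let ?n = "length q" and ?s = "to_frac R s" and ?e = "ring.eval ?K q x"
    obtain c' where c': "c' \<in> carrier R" "c = to_frac R c'" using Cons.prems by auto
    obtain r where r: "r \<in> carrier R"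
      "?e \<otimes>\<^bsub>?K\<^esub> (?s [^]\<^bsub>?K\<^esub> ?n) = to_frac R (s \<otimes> r)" using Cons by auto
    have e: "?e \<in> carrier ?K" using Cons.prems xK by (intro K.eval_in_carrier) auto
    have pw: "(x [^]\<^bsub>?K\<^esub> ?n) \<otimes>\<^bsub>?K\<^esub> (?s [^]\<^bsub>?K\<^esub> ?n) = to_frac R (a [^] ?n)"
      using K.nat_pow_distrib[OF xK, of ?s ?n] xs s a by simp
    have cK: "c \<in> carrier ?K" "?s \<in> carrier ?K" using c' s by auto
    have pK: "x [^]\<^bsub>?K\<^esub> ?n \<in> carrier ?K" "?s [^]\<^bsub>?K\<^esub> ?n \<in> carrier ?K" using xK cK by auto
    have "ring.eval ?K (c # q) x \<otimes>\<^bsub>?K\<^esub> (?s [^]\<^bsub>?K\<^esub> length (c # q))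
      = (c \<otimes>\<^bsub>?K\<^esub> (x [^]\<^bsub>?K\<^esub> ?n) \<oplus>\<^bsub>?K\<^esub> ?e) \<otimes>\<^bsub>?K\<^esub> ((?s [^]\<^bsub>?K\<^esub> ?n) \<otimes>\<^bsub>?K\<^esub> ?s)"
      by simp
    also have "\<dots> = c \<otimes>\<^bsub>?K\<^esub> ((x [^]\<^bsub>?K\<^esub> ?n) \<otimes>\<^bsub>?K\<^esub> (?s [^]\<^bsub>?K\<^esub> ?n)) \<otimes>\<^bsub>?K\<^esub> ?s
      \<oplus>\<^bsub>?K\<^esub> (?e \<otimes>\<^bsub>?K\<^esub> (?s [^]\<^bsub>?K\<^esub> ?n)) \<otimes>\<^bsub>?K\<^esub> ?s"
      using cK e pK by (simp add: K.l_distr K.m_assoc)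
    also have "\<dots> = to_frac R (c' \<otimes> a [^] ?n \<otimes> s \<oplus> (s \<otimes> r) \<otimes> s)"
      unfolding pw r(2) c'(2) using c' r s a by simp
    also have "c' \<otimes> a [^] ?n \<otimes> s \<oplus> (s \<otimes> r) \<otimes> s = s \<otimes> (c' \<otimes> a [^] ?n \<oplus> s \<otimes> r)"
      using c' r s a by (simp add: r_distr m_ac)
    finally show ?case using c' r s a by (intro bexI[of _ "c' \<otimes> a [^] ?n \<oplus> s \<otimes> r"]) auto
  qed
  obtain p where p: "p \<in> carrier (?A[X]\<^bsub>?K\<^esub>)" "p \<noteq> []" "hd p = \<one>\<^bsub>?K\<^esub>" "ring.eval ?K p x = \<zero>\<^bsub>?K\<^esub>"
    using int unfolding integral_over_def by blast
  then obtain q where q: "p = \<one>\<^bsub>?K\<^esub> # q" by (cases p) auto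
  let ?n = "length q" and ?s = "to_frac R s" and ?e = "ring.eval ?K q x"
  have qA: "set q \<subseteq> ?A" using p(1) unfolding q univ_poly_def polynomial_def by auto
  then obtain r where r: "r \<in> carrier R" "?e \<otimes>\<^bsub>?K\<^esub> (?s [^]\<^bsub>?K\<^esub> ?n) = to_frac R (s \<otimes> r)"
    using clear by blast
  have sK: "?s \<in> carrier ?K" using s by simp
  have e: "?e \<in> carrier ?K" using qA xK by (intro K.eval_in_carrier) auto
  have pw: "(x [^]\<^bsub>?K\<^esub> ?n) \<otimes>\<^bsub>?K\<^esub> (?s [^]\<^bsub>?K\<^esub> ?n) = to_frac R (a [^] ?n)"
    using K.nat_pow_distrib[OF xK, of ?s ?n] xs s a by simp
  have "\<zero>\<^bsub>?K\<^esub> = (x [^]\<^bsub>?K\<^esub> ?n \<oplus>\<^bsub>?K\<^esub> ?e) \<otimes>\<^bsub>?K\<^esub> (?s [^]\<^bsub>?K\<^esub> ?n)"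
    using p(4) xK sK e unfolding q by simp
  also have "\<dots> = to_frac R (a [^] ?n \<oplus> s \<otimes> r)"
    using xK sK e pw r a s by (simp add: K.l_distr)
  finally have "to_frac R (a [^] ?n \<oplus> s \<otimes> r) = to_frac R \<zero>" by simp
  then have "a [^] ?n \<oplus> s \<otimes> r = \<zero>"
    using inj_onD[OF inj_to_frac] a r s by simp
  then have "a [^] ?n = s \<otimes> (\<ominus> r)"
    using a r s by (metis minus_equality m_closed nat_pow_closed r_minus)
  then have dvd: "\<exists>w\<in>carrier R. a [^] ?n = s \<otimes> w" using r by blast
  have "\<exists>w\<in>carrier R. \<one> = s \<otimes> w" if "\<exists>w\<in>carrier R. a [^] m = s \<otimes> w" for m :: nat
    using that
  proof (induction m)
    case 0
    then show ?case by simp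
  next
    case (Suc m)
    then obtain w where w: "w \<in> carrier R" "a [^] m \<otimes> a = s \<otimes> w" by auto
    have am: "a [^] m \<in> carrier R" using a by simp
    have "a [^] m = a [^] m \<otimes> (u \<otimes> a \<oplus> v \<otimes> s)" using bezout[symmetric] a by simp
    also have "\<dots> = u \<otimes> (a [^] m \<otimes> a) \<oplus> a [^] m \<otimes> v \<otimes> s"
      using am a uv(1,2) s(1) by (simp add: r_distr m_ac)
    also have "\<dots> = s \<otimes> (u \<otimes> w \<oplus> a [^] m \<otimes> v)"
      unfolding w(2) using am w(1) uv(1,2) s(1) by (simp add: r_distr m_ac)
    finally have "\<exists>w\<in>carrier R. a [^] m = s \<otimes> w" using am w(1) uv(1,2) by blast
    then show ?case by (rule Suc.IH)
  qed
  then obtain w where w: "w \<in> carrier R" "\<one> = s \<otimes> w" using dvd by blast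
  have "x = to_frac R (a \<otimes> w)"
    unfolding x to_frac_def using a s nz w
    by (subst frac_eq_iff) (simp_all add: m_assoc m_comm[of w s] flip: w(2))
  then show "x \<in> ?A" using a w by blast
qed

sublocale principal_domain \<subseteq> dedekind_domain
proof (intro dedekind_domain.intro dedekind_domain_axioms.intro noetherian_domain_axioms)
  show "integrally_closed R" by (rule principal_domain_integrally_closed)
next
  fix P assume P: "primeideal P R" "P \<noteq> {\<zero>}"
  obtain p where p: "p \<in> carrier R" "P = PIdl p"
    using exists_gen[OF primeideal.axioms(1)[OF P(1)]] by blast
  moreover have "p \<noteq> \<zero>"
    using P(2) p(2) by (auto simp: cgenideal_eq_genideal genideal_zero)
  ultimately have "ring_irreducible p"
    using P(1) primeness_condition primeideal_iff_prime[of p] by simp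
  then show "maximalideal P R"
    using irreducible_imp_maximalideal[OF p(1)] p(2) by simp
qed

end

theory Submission
  imports Defs
begin

text \<open>In a noetherian ring only finitely many primes are minimal over a given ideal. If the
  ideal contains a nonzero element and nonzero primes are maximal, these are all the primes
  containing it, so every proper closed set of the spectrum is finite.\<close>

text \<open>A maximal counterexample \<open>M\<close> is impossible, since every ideal strictly
  above \<open>M\<close> satisfies \<open>Q\<close> and then \<open>step\<close> yields
  \<open>Q M\<close>.\<close>

lemma (in noetherian_ring) noetherian_induct [consumes 1, case_names ideal]:
  assumes "ideal I R"
    and step: "\<And>I. ideal I R \<Longrightarrow> (\<And>J. ideal J R \<Longrightarrow> I \<subset> J \<Longrightarrow> Q J) \<Longrightarrow> Q I"
  shows "Q I"
proof (rule ccontr)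
  let ?B = "{I. ideal I R \<and> \<not> Q I}"
  assume "\<not> Q I"
  then have "?B \<noteq> {}" using assms(1) by blast
  \<comment> \<open>By the ascending chain condition the union of a nonempty chain of ideals belongs
    to the chain, so it is again a counterexample and Zorn's lemma applies.\<close>
  moreover have "\<Union>C \<in> ?B" if C: "C \<noteq> {}" "subset.chain ?B C" for C
  proof -
    have "subset.chain {I. ideal I R} C"
      using C(2) unfolding pred_on.chain_def by blast
    from ideal_chain_is_trivial[OF C(1) this] show ?thesis
      using C(2) unfolding pred_on.chain_def by blast
  qed
  ultimately obtain M where M: "M \<in> ?B" "\<And>J. J \<in> ?B \<Longrightarrow> M \<subseteq> J \<Longrightarrow> J = M"
    using subset_Zorn_nonempty[of ?B] by blast
  have "Q M"
    by (rule step) (use M in blast)+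
  then show False using M(1) by blast
qed

text \<open>The set \<open>F\<close> need not consist of the minimal primes over \<open>I\<close>, but it contains them.\<close>

lemma finite_primes_below:
  fixes R (structure)
  assumes "noetherian_ring R" "cring R" "ideal I R"
  shows "\<exists>F. finite F \<and> F \<subseteq> vanishing R I \<and> (\<forall>P \<in> vanishing R I. \<exists>Q \<in> F. Q \<subseteq> P)"
proof -
  interpret noetherian_ring R by fact
  interpret cring R by fact
  from \<open>ideal I R\<close> show ?thesis
  proof (induction rule: noetherian_induct)
    case (ideal I)
    interpret I: ideal I R by fact
    \<comment> \<open>In the third case \<open>I\<close> is replaced by the two strictly larger
      ideals generated by adjoining \<open>x\<close> or \<open>y\<close>.\<close>
    consider "primeideal I R" | "carrier R = I" | x y where
      "x \<in> carrier R" "y \<in> carrier R" "x \<otimes> y \<in> I" "x \<notin> I" "y \<notin> I"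
      using I.primeidealCE[OF is_cring] by metis
    then show ?case
    proof cases
      case 1
      then show ?thesis
        by (intro exI[of _ "{I}"]) (auto simp: vanishing_def Spec_def)
    next
      case 2
      have "vanishing R I = {}"
        unfolding vanishing_def Spec_def
        using 2 primeideal.I_notcarr ideal.Icarr primeideal.axioms(1) by fastforce
      then show ?thesis by auto
    next
      case (3 x y)
      \<comment> \<open>The induction hypothesis needs an ideal, so it is applied to
        \<open>Idl (insert z I)\<close>, which lies in the same primes as
        \<open>insert z I\<close>.\<close>
      have extend: "\<exists>F. finite F \<and> F \<subseteq> vanishing R (insert z I) \<and>
          (\<forall>P \<in> vanishing R (insert z I). \<exists>Q \<in> F. Q \<subseteq> P)"
        if z: "z \<in> carrier R" "z \<notin> I" for z
      proof -
        have sub: "insert z I \<subseteq> carrier R" using z I.Icarr by blast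
        have "vanishing R (Idl (insert z I)) = vanishing R (insert z I)"
          unfolding vanishing_def Spec_def
          using genideal_self[OF sub] genideal_minimal primeideal.axioms(1) by blast
        moreover have "I \<subset> Idl (insert z I)" using genideal_self[OF sub] z by blast
        ultimately show ?thesis using ideal.IH[OF genideal_ideal[OF sub]] by simp
      qed
      \<comment> \<open>A prime containing \<open>I\<close> contains \<open>x \<otimes> y\<close>,
        hence one of the factors.\<close>
      have vanishing_I: "vanishing R I = vanishing R (insert x I) \<union> vanishing R (insert y I)"
      proof -
        have "x \<in> P \<or> y \<in> P" if "primeideal P R" "I \<subseteq> P" for P
          using primeideal.I_prime[OF that(1) 3(1,2)] 3(3) that(2) by blast
        then show ?thesis by (auto simp: vanishing_def Spec_def)
      qed
      obtain F where F: "finite F" "F \<subseteq> vanishing R (insert x I)"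
        "\<forall>P \<in> vanishing R (insert x I). \<exists>Q \<in> F. Q \<subseteq> P"
        using extend[OF 3(1,4)] by (elim exE conjE)
      obtain G where G: "finite G" "G \<subseteq> vanishing R (insert y I)"
        "\<forall>P \<in> vanishing R (insert y I). \<exists>Q \<in> G. Q \<subseteq> P"
        using extend[OF 3(2,5)] by (elim exE conjE)
      show ?thesis
        unfolding vanishing_I using F G by (intro exI[of _ "F \<union> G"] conjI) blast+
    qed
  qed
qed

text \<open>Any prime containing \<open>E\<close> contains \<open>PIdl a\<close>, and
  \<open>finite_primes_below\<close> applies to this ideal. \<open>E\<close> is a mere set because
  that is how \<open>zariski\<close> presents its open sets.\<close>

lemma (in dedekind_domain) finite_vanishing:
  assumes "a \<in> carrier R" "a \<noteq> \<zero>" "a \<in> E"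
  shows "finite (vanishing R E)"
proof -
  have idl: "ideal (PIdl a) R" and a: "a \<in> PIdl a"
    using assms(1) cgenideal_ideal cgenideal_self by auto
  obtain F where F: "finite F" "F \<subseteq> vanishing R (PIdl a)"
    "\<And>P. P \<in> vanishing R (PIdl a) \<Longrightarrow> \<exists>Q \<in> F. Q \<subseteq> P"
    using finite_primes_below[OF noetherian_ring_axioms is_cring idl] by metis
  have "P \<in> F" if "P \<in> vanishing R E" for P
  proof -
    have P: "primeideal P R" "a \<in> P"
      using that assms(3) by (auto simp: vanishing_def Spec_def)
    interpret P: primeideal P R by fact
    have "P \<in> vanishing R (PIdl a)"
      using P cgenideal_minimal[OF P.is_ideal] by (auto simp: vanishing_def Spec_def)
    then obtain Q where Q: "Q \<in> F" "Q \<subseteq> P" using F(3) by blast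
    \<comment> \<open>\<open>Q\<close> contains \<open>PIdl a\<close>, hence the nonzero element
      \<open>a\<close>.\<close>
    then have "primeideal Q R" "Q \<noteq> {\<zero>}"
      using F(2) a assms(2) by (auto simp: vanishing_def Spec_def)
    then interpret Q: maximalideal Q R by (rule nonzero_prime_maximal)
    have "P = Q"
      using Q.I_maximal[OF P.is_ideal Q(2)] P.Icarr P.I_notcarr by blast
    then show ?thesis using Q(1) by simp
  qed
  then show ?thesis by (intro finite_subset[OF _ F(1)] subsetI)
qed

theorem corollary3p7:
  fixes R :: "('a, 'b) ring_scheme" and S :: "'a set set"
  assumes "principal_domain R \<or> dedekind_domain R"
    and "S \<subseteq> Spec R"
    and "infinite S"
  shows "zariski R closure_of S = Spec R"
proof -
  have "dedekind_domain R" if "principal_domain R"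
  proof -
    interpret principal_domain R by fact
    show ?thesis by (rule dedekind_domain_axioms)
  qed
  then interpret dedekind_domain R using assms(1) by blast
  have "\<exists>P. P \<in> S \<and> P \<in> U" if U: "P \<in> U" "openin (zariski R) U" for P U
  proof -
    obtain E where E: "E \<subseteq> carrier R" "U = Spec R - vanishing R E"
      using U(2) openin_zariski[OF is_cring] by blast
    have P: "primeideal P R" "\<not> E \<subseteq> P"
      using U(1) E(2) by (auto simp: vanishing_def Spec_def)
    interpret P: primeideal P R by fact
    \<comment> \<open>An element of \<open>E\<close> outside \<open>P\<close> is nonzero because
      \<open>P\<close> contains zero; this is where nonemptiness of \<open>U\<close> enters.\<close>
    obtain a where "a \<in> E" "a \<noteq> \<zero>\<^bsub>R\<^esub>" using P(2) P.zero_closed by blast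
    then have "finite (vanishing R E)" using E(1) finite_vanishing by blast
    then have "\<not> S \<subseteq> vanishing R E" using assms(3) finite_subset by metis
    then show ?thesis using assms(2) E(2) by blast
  qed
  then show ?thesis
    unfolding closure_of_def topspace_zariski[OF is_cring] by blast
qed

end
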